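(* Let $F\in\mathbb{R}^{M\times N}$, $\mathbf{y}\in\mathbb{R}^M$, and let $R\in\mathbb{R}^{K\times N}$ satisfy $\ker(F)\cap\ker(R)=\{\mathbf{0}_N\}$. Let $r\in\mathbb{R}\setminus\{0\}$, $\beta>0$, $\vartheta_1,\dots,\vartheta_K>0$, and $\eta=r\beta-\tfrac32$. Fix any noise variance $\nu>0$ and let $\mathcal{G}(\mathbf{x},\boldsymbol{\theta};\nu)$ be the objective function defined in the context, regarded as a function of $(\mathbf{x},\boldsymbol{\theta})$. 1. If $r\ge1$ and $\eta>0$, then $\mathcal{G}(\mathbf{x},\boldsymbol{\theta};\nu)$ is globally strictly convex in the variables $(\mathbf{x},\boldsymbol{\theta})$. 2. If $0<r<1$ and $\eta>0$, or if $r<0$, then $\mathcal{G}(\mathbf{x},\boldsymbol{\theta};\nu)$ is locally convex in $(\mathbf{x},\boldsymbol{\theta})$ at $(\mathbf{x},\boldsymbol{\theta})\in\mathbb{R}^N\times\mathbb{R}_{++}^K$ provided that $$\theta_i<\vartheta_i\left(\frac{\eta}{r|r-1|}\right)^{1/r},\quad i=1,\dots,K.$$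
   Context: $\mathbb{R}_{++}$ denotes the positive reals and $D_{\boldsymbol{\theta}}=\operatorname{diag}(\theta_1,\dots,\theta_K)$. For parameters $\tilde r\in\mathbb{R}\setminus\{0\}$, $\tilde\beta,\tilde\vartheta>0$ and $\tilde\eta=\tilde r\tilde\beta-\tfrac{M+2}{2}$, the objective is $$\mathcal{G}(\mathbf{x},\boldsymbol{\theta};\nu)=\frac{1}{2\nu}\|F\mathbf{x}-\mathbf{y}\|_2^2+\frac12\|D_{\boldsymbol{\theta}}^{-1/2}R\mathbf{x}\|_2^2+\left(\frac{\nu}{\tilde\vartheta}\right)^{\tilde r}+\sum_{i=1}^K\left(\frac{\theta_i}{\vartheta_i}\right)^r-\tilde\eta\log\nu-\eta\sum_{i=1}^K\log\theta_i$$ if all $\theta_i>0$, and $+\infty$ otherwise (the terms depending only on $\nu$ are constants here). "Globally strictly convex" means strictly convex on the effective domain $\mathbb{R}^N\times\mathbb{R}_{++}^K$. "Locally convex at a point" means convex on some neighborhood of that point. *)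

theory Defs
  imports "HOL-Analysis.Analysis"
begin

text \<open>Convexity of extended-real-valued functions, following the library's \<open>convex_on\<close>,
  which covers real-valued functions only.\<close>

definition ereal_convex_on :: "'a::real_vector set \<Rightarrow> ('a \<Rightarrow> ereal) \<Rightarrow> bool" where
  "ereal_convex_on S f \<longleftrightarrow> convex S \<and>
    (\<forall>x\<in>S. \<forall>y\<in>S. \<forall>u\<ge>0. \<forall>v\<ge>0. u + v = 1 \<longrightarrow>
      f (u *\<^sub>R x + v *\<^sub>R y) \<le> ereal u * f x + ereal v * f y)"

definition ereal_strictly_convex_on :: "'a::real_vector set \<Rightarrow> ('a \<Rightarrow> ereal) \<Rightarrow> bool" where
  "ereal_strictly_convex_on S f \<longleftrightarrow> convex S \<and>
    (\<forall>x\<in>S. \<forall>y\<in>S. \<forall>u>0. \<forall>v>0. x \<noteq> y \<and> u + v = 1 \<longrightarrow>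
      f (u *\<^sub>R x + v *\<^sub>R y) < ereal u * f x + ereal v * f y)"

definition effective_domain :: "('a \<Rightarrow> ereal) \<Rightarrow> 'a set" where
  "effective_domain f = {x. f x < \<infinity>}"

definition globally_strictly_convex :: "('a::real_vector \<Rightarrow> ereal) \<Rightarrow> bool" where
  "globally_strictly_convex f \<longleftrightarrow> ereal_strictly_convex_on (effective_domain f) f"

definition locally_convex_at :: "('a::real_normed_vector \<Rightarrow> ereal) \<Rightarrow> 'a \<Rightarrow> bool" where
  "locally_convex_at f p \<longleftrightarrow> (\<exists>U. open U \<and> p \<in> U \<and> ereal_convex_on U f)"

lemma ereal_convex_on_iff_convex_on:
  assumes "\<And>x. x \<in> S \<Longrightarrow> f x = ereal (g x)"
  shows "ereal_convex_on S f \<longleftrightarrow> convex_on S g"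
proof (cases "convex S")
  case True
  then have "f (u *\<^sub>R x + v *\<^sub>R y) = ereal (g (u *\<^sub>R x + v *\<^sub>R y))"
    if "x \<in> S" "y \<in> S" "u \<ge> 0" "v \<ge> 0" "u + v = 1" for x y u v
    using assms that by (simp add: convexD)
  then show ?thesis
    using assms by (simp add: ereal_convex_on_def convex_on_def)
qed (simp add: ereal_convex_on_def convex_on_def)

definition matrix_kernel :: "real^'n^'m \<Rightarrow> (real^'n) set" where
  "matrix_kernel A = {x. A *v x = 0}"

definition diag_matrix :: "real^'k \<Rightarrow> real^'k^'k" where
  "diag_matrix d = (\<chi> i j. if i = j then d $ i else 0)"

text \<open>The matrix \<open>D\<^sub>\<theta>\<close> to the power \<open>-1/2\<close> is the diagonal matrix with
  entries \<open>\<theta>\<^sub>i powr (-1/2)\<close>; it is used only for positive \<open>\<theta>\<close>.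
  The scale parameters (vartheta) are \<open>\<theta>0\<close>; primed parameters (those with a tilde)
  belong to the noise variance \<open>\<nu>\<close>.\<close>

definition objective ::
  "real^'n^'m \<Rightarrow> real^'m \<Rightarrow> real^'n^'k \<Rightarrow> real \<Rightarrow> real \<Rightarrow> real^'k \<Rightarrow>
   real \<Rightarrow> real \<Rightarrow> real \<Rightarrow> real \<Rightarrow> (real^'n) \<times> (real^'k) \<Rightarrow> ereal" where
  "objective F y R r \<eta> \<theta>0 r' \<eta>' \<theta>0' \<nu> = (\<lambda>(x, \<theta>).
     if \<forall>i. \<theta> $ i > 0 then ereal (
       1 / (2 * \<nu>) * (norm (F *v x - y))\<^sup>2
       + 1 / 2 * (norm (diag_matrix (\<chi> i. (\<theta> $ i) powr (- 1 / 2)) *v (R *v x)))\<^sup>2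
       + (\<nu> / \<theta>0') powr r'
       + (\<Sum>i\<in>UNIV. (\<theta> $ i / \<theta>0 $ i) powr r)
       - \<eta>' * ln \<nu>
       - \<eta> * (\<Sum>i\<in>UNIV. ln (\<theta> $ i)))
     else \<infinity>)"

lemma effective_domain_objective:
  "effective_domain (objective F y R r \<eta> \<theta>0 r' \<eta>' \<theta>0' \<nu>) = UNIV \<times> {\<theta>. \<forall>i. \<theta> $ i > 0}"
  by (auto simp: effective_domain_def objective_def split: if_splits)

end

theory Submission
  imports Defs
begin

text \<open>
  For fixed \<open>\<nu>\<close> and positive \<open>\<theta>\<close> the objective is, up to a constant,
  the sum of a quadratic \<open>a \<parallel>F x - y\<parallel>\<^sup>2\<close>, of the perspective functions
  \<open>(R x)\<^sub>i\<^sup>2 / (2 \<theta>\<^sub>i)\<close>, and of the one-variable functions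
  \<open>h\<^sub>i(t) = (t / \<theta>0\<^sub>i) powr r - \<eta> ln t\<close> at \<open>t = \<theta>\<^sub>i\<close>. The first two kinds are always
  convex jointly in \<open>(x, \<theta>)\<close>; their Jensen gaps are explicit squares, given by
  \<open>norm_power2_convex_combination\<close> and \<open>square_over_convex_combination\<close>. Convexity of the
  whole therefore reduces to that of the \<open>h\<^sub>i\<close> on an interval.

  Since \<open>t\<^sup>2 h\<^sub>i''(t) = r (r - 1) (t / \<theta>0\<^sub>i) powr r + \<eta>\<close>, the bound on \<open>\<theta>\<^sub>i\<close> in the second
  part is exactly the inequality \<open>h\<^sub>i'' > 0\<close>. This bound cuts out
  an open box in \<open>\<theta>\<close>, which together with all of the \<open>x\<close>-space serves as the neighbourhood.

  In the first part each \<open>h\<^sub>i\<close> is a convex power plus a positive multiple of the strictly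
  convex \<open>- ln\<close>. Strictness in \<open>(x, \<theta>)\<close> then comes from one of three places: from some \<open>h\<^sub>i\<close>
  if the two \<open>\<theta>\<close> differ; from the data term if the two values \<open>F x\<close> differ; and otherwise
  the kernel condition forces the two \<open>R x\<close> to differ over the same \<open>\<theta>\<close>, which makes the
  gap of some perspective function positive.
\<close>

section \<open>Jensen gaps of the quadratic, perspective and logarithmic terms\<close>

text \<open>The defect in Jensen's inequality for the squared norm is a multiple of the squared
  distance; for positive weights it is nonnegative and vanishes only for equal arguments.\<close>

lemma norm_power2_convex_combination:
  fixes a b :: "'a::real_inner"
  assumes "u + v = 1"
  shows "(norm (u *\<^sub>R a + v *\<^sub>R b))\<^sup>2
       = u * (norm a)\<^sup>2 + v * (norm b)\<^sup>2 - u * v * (norm (a - b))\<^sup>2"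
proof -
  have v: "v = 1 - u" using assms by simp
  show ?thesis unfolding v
    by (simp add: power2_norm_eq_inner inner_add_left inner_add_right inner_diff_left
        inner_diff_right inner_commute algebra_simps)
qed

text \<open>The same for the perspective \<open>a\<^sup>2 / s\<close> of the square. The defect vanishes when
  \<open>a / s = b / t\<close>, so this function is not strictly convex; for positive weights the
  inequality is strict between distinct points that share the denominator.\<close>

lemma square_over_convex_combination:
  fixes a b s t u v :: real
  assumes "s > 0" "t > 0" "u * s + v * t > 0" "u + v = 1"
  shows "(u * a + v * b)\<^sup>2 / (u * s + v * t)
       = u * (a\<^sup>2 / s) + v * (b\<^sup>2 / t) - u * v * (a * t - b * s)\<^sup>2 / (s * t * (u * s + v * t))"
proof -
  have v: "v = 1 - u" using assms by simp
  have nz: "s \<noteq> 0" "t \<noteq> 0" "u * s + v * t \<noteq> 0" using assms by auto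
  have "((u * a + v * b)\<^sup>2) * (s * t)
      = (u * a\<^sup>2 * t + v * b\<^sup>2 * s) * (u * s + v * t) - u * v * (a * t - b * s)\<^sup>2"
    unfolding v by (simp add: power2_eq_square algebra_simps)
  then show ?thesis using nz
    by (simp add: divide_simps)
qed

text \<open>Strict concavity of the logarithm: at the mean \<open>m = u s + v t\<close> the tangent bound
  \<open>ln (s / m) \<le> s / m - 1\<close> is strict because \<open>s \<noteq> m\<close>, and the right-hand sides average to 0.\<close>

lemma ln_strictly_concave:
  fixes s t u v :: real
  assumes "s > 0" "t > 0" "u > 0" "v > 0" "u + v = 1" "s \<noteq> t"
  shows "u * ln s + v * ln t < ln (u * s + v * t)"
proof -
  define m where "m = u * s + v * t"
  have m: "m > 0" unfolding m_def using assms by (simp add: add_pos_pos)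
  have v: "v = 1 - u" using assms by simp
  have "s - m = v * (s - t)" unfolding m_def v by (simp add: algebra_simps)
  then have "s \<noteq> m" using assms by auto
  then have "ln (s / m) \<noteq> s / m - 1"
    using ln_eq_minus_one[of "s / m"] m assms by auto
  then have s: "ln s - ln m < s / m - 1"
    using ln_le_minus_one[of "s / m"] m assms by (simp add: ln_div)
  have t: "ln t - ln m \<le> t / m - 1"
    using ln_le_minus_one[of "t / m"] m assms by (simp add: ln_div)
  have "u * (ln s - ln m) + v * (ln t - ln m) < u * (s / m - 1) + v * (t / m - 1)"
    using s t assms by (intro add_less_le_mono mult_strict_left_mono mult_left_mono) auto
  also have "\<dots> = (u * s + v * t) / m - (u + v)" by (simp add: algebra_simps add_divide_distrib)
  also have "\<dots> = 0" using m assms by (simp flip: m_def)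
  finally have "u * ln s + v * ln t < (u + v) * ln m" by (simp add: algebra_simps)
  then show ?thesis using assms by (simp add: m_def)
qed

section \<open>The one-variable terms in the variances\<close>

lemma convex_on_powr_minus_ln:
  fixes c r \<eta> :: real
  assumes "c > 0" "convex I" "I \<subseteq> {0<..}"
    and nonneg: "\<And>t. t \<in> I \<Longrightarrow> r * (r - 1) * (t / c) powr r + \<eta> \<ge> 0"
  shows "convex_on I (\<lambda>t. (t / c) powr r - \<eta> * ln t)"
proof (rule f''_ge0_imp_convex)
  fix t assume t: "t \<in> I"
  then have pos: "t > 0" using assms by auto
  have power: "((\<lambda>t. (t / c) powr e) has_real_derivative e * (t / c) powr (e - 1) / c) (at t)" for e
    using pos \<open>c > 0\<close> by (auto intro!: derivative_eq_intros simp: powr_diff field_simps)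
  show "((\<lambda>t. (t / c) powr r - \<eta> * ln t) has_real_derivative r * (t / c) powr (r - 1) / c - \<eta> / t) (at t)"
    using pos \<open>c > 0\<close> by (auto intro!: derivative_eq_intros power)
  have "((\<lambda>t. \<eta> / t) has_real_derivative - \<eta> / t\<^sup>2) (at t)"
    using pos by (auto intro!: derivative_eq_intros simp: power2_eq_square)
  from DERIV_diff[OF DERIV_cdivide[OF DERIV_cmult[OF power]] this]
  have "((\<lambda>t. r * (t / c) powr (r - 1) / c - \<eta> / t) has_real_derivative
      r * ((r - 1) * (t / c) powr (r - 1 - 1) / c) / c - - \<eta> / t\<^sup>2) (at t)" .
  also have "r * ((r - 1) * (t / c) powr (r - 1 - 1) / c) / c - - \<eta> / t\<^sup>2
      = (r * (r - 1) * (t / c) powr r + \<eta>) / t\<^sup>2"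
    using pos \<open>c > 0\<close> by (simp add: powr_diff field_simps power2_eq_square)
  finally show "((\<lambda>t. r * (t / c) powr (r - 1) / c - \<eta> / t) has_real_derivative
      (r * (r - 1) * (t / c) powr r + \<eta>) / t\<^sup>2) (at t)" .
  show "(r * (r - 1) * (t / c) powr r + \<eta>) / t\<^sup>2 \<ge> 0"
    using nonneg[OF t] by simp
qed (use assms in auto)

text \<open>The bound on \<open>t\<close> is the zero of \<open>t\<^sup>2 h''(t)\<close>, where \<open>h(t) = (t / c) powr r - \<eta> ln t\<close>.
  Raising \<open>t / c\<close> to the power \<open>r\<close> reverses the inequality if \<open>r < 0\<close>, and multiplying by
  the negative number \<open>r (r - 1)\<close> reverses it if \<open>0 < r < 1\<close>: each case has exactly one
  reversal, so both end with the same sign.\<close>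

lemma curvature_nonneg_below_threshold:
  fixes c r \<eta> t :: real
  assumes "c > 0" "t > 0" and cases: "0 < r \<and> r < 1 \<and> \<eta> > 0 \<or> r < 0 \<and> \<eta> < 0"
    and less: "t < c * (\<eta> / (r * \<bar>r - 1\<bar>)) powr (1 / r)"
  shows "r * (r - 1) * (t / c) powr r + \<eta> \<ge> 0"
proof -
  define q where "q = \<eta> / (r * \<bar>r - 1\<bar>)"
  have q: "q > 0"
    using cases
  proof
    assume "0 < r \<and> r < 1 \<and> \<eta> > 0"
    then show ?thesis unfolding q_def by (intro divide_pos_pos mult_pos_pos) auto
  next
    assume "r < 0 \<and> \<eta> < 0"
    then show ?thesis unfolding q_def by (intro divide_neg_neg mult_neg_pos) auto
  qed
  have tc: "t / c > 0" "t / c < q powr (1 / r)"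
    using assms by (auto simp: q_def field_simps)
  have qr: "(q powr (1 / r)) powr r = q" using cases q by (auto simp: powr_powr)
  from cases show ?thesis
  proof
    assume r: "0 < r \<and> r < 1 \<and> \<eta> > 0"
    have "(t / c) powr r < (q powr (1 / r)) powr r"
      using r tc by (intro powr_less_mono2) auto
    then have "(t / c) powr r < \<eta> / (r * (1 - r))" using r qr by (simp add: q_def)
    then have "(t / c) powr r * (r * (1 - r)) < \<eta>" using r by (simp add: pos_less_divide_eq)
    then show ?thesis by (simp add: algebra_simps)
  next
    assume r: "r < 0 \<and> \<eta> < 0"
    have "(q powr (1 / r)) powr r < (t / c) powr r"
      using r tc by (intro powr_less_mono2_neg) auto
    then have less: "q < (t / c) powr r" by (simp only: qr)
    have pos: "r * (r - 1) > 0" using r by (simp add: mult_neg_neg)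
    have "q = (- \<eta>) / (r * (r - 1))" using r by (simp add: q_def field_simps)
    then have "- \<eta> = q * (r * (r - 1))" using r by simp
    also have "\<dots> < (t / c) powr r * (r * (r - 1))"
      using less pos by (rule mult_strict_right_mono)
    finally have "- \<eta> < (t / c) powr r * (r * (r - 1))" .
    then show ?thesis by (simp add: algebra_simps)
  qed
qed

lemma powr_minus_ln_strictly_convex:
  fixes c r \<eta> s t u v :: real
  assumes "c > 0" "r \<ge> 1" "\<eta> > 0" "s > 0" "t > 0" "u > 0" "v > 0" "u + v = 1" "s \<noteq> t"
  shows "((u * s + v * t) / c) powr r - \<eta> * ln (u * s + v * t)
       < u * ((s / c) powr r - \<eta> * ln s) + v * ((t / c) powr r - \<eta> * ln t)"
proof -
  \<comment> \<open>The power alone, as the case \<open>\<eta> = 0\<close> of the second-derivative test.\<close>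
  have "convex_on {0<..} (\<lambda>t. (t / c) powr r - 0 * ln t)"
    using assms by (intro convex_on_powr_minus_ln) auto
  then have "((u * s + v * t) / c) powr r \<le> u * (s / c) powr r + v * (t / c) powr r"
    using assms by (auto simp: convex_on_def)
  moreover have "\<eta> * (u * ln s + v * ln t) < \<eta> * ln (u * s + v * t)"
    using assms ln_strictly_concave by (intro mult_strict_left_mono) auto
  ultimately show ?thesis by (simp add: algebra_simps)
qed

section \<open>Convexity of the coupled objective\<close>

text \<open>The objective with the one-variable terms left abstract: both parts of the theorem use
  the same coupling of \<open>x\<close> with \<open>\<theta>\<close> and differ only in what is known about \<open>h\<close>.\<close>

definition coupled_objective ::
  "real \<Rightarrow> real \<Rightarrow> real^'n^'m \<Rightarrow> real^'m \<Rightarrow> real^'n^'k \<Rightarrow> ('k \<Rightarrow> real \<Rightarrow> real) \<Rightarrow>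
   (real^'n) \<times> (real^'k) \<Rightarrow> real" where
  "coupled_objective c a F y R h = (\<lambda>(x, \<theta>).
     c + a * (norm (F *v x - y))\<^sup>2
       + (\<Sum>i\<in>UNIV. ((R *v x) $ i)\<^sup>2 / (\<theta> $ i) / 2 + h i (\<theta> $ i)))"

lemma diag_matrix_mult_vec: "(diag_matrix d *v z) $ i = d $ i * z $ i"
  by (simp add: diag_matrix_def matrix_vector_mult_def if_distrib[of "\<lambda>x. x * _"] cong: if_cong)

lemma norm_power2_vec: "(norm (z :: real^'k))\<^sup>2 = (\<Sum>i\<in>UNIV. (z $ i)\<^sup>2)"
  by (simp add: norm_vec_def L2_set_def sum_nonneg)

lemma objective_eq_coupled_objective:
  fixes F :: "real^'n^'m" and R :: "real^'n^'k"
  assumes "\<And>i. \<theta> $ i > 0"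
  shows "objective F y R r \<eta> \<theta>0 r' \<eta>' \<theta>0' \<nu> (x, \<theta>)
       = ereal (coupled_objective ((\<nu> / \<theta>0') powr r' - \<eta>' * ln \<nu>) (1 / (2 * \<nu>)) F y R
           (\<lambda>i t. (t / \<theta>0 $ i) powr r - \<eta> * ln t) (x, \<theta>))"
proof -
  have sq: "(\<theta> $ i powr (- 1 / 2) * z)\<^sup>2 = z\<^sup>2 / \<theta> $ i" for i z
  proof -
    have "(\<theta> $ i powr (- 1 / 2))\<^sup>2 = \<theta> $ i powr (- 1)"
      using assms[of i] by (simp add: power2_eq_square flip: powr_add)
    then show ?thesis using assms[of i] by (simp add: power_mult_distrib powr_minus field_simps)
  qed
  have norm: "(norm (diag_matrix (\<chi> i. \<theta> $ i powr (- 1 / 2)) *v (R *v x)))\<^sup>2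
      = (\<Sum>i\<in>UNIV. ((R *v x) $ i)\<^sup>2 / \<theta> $ i)"
    by (simp only: norm_power2_vec diag_matrix_mult_vec vec_lambda_beta sq)
  show ?thesis using assms unfolding objective_def coupled_objective_def prod.case norm
    by (simp add: sum.distrib sum_subtractf sum_distrib_left sum_divide_distrib mult.commute)
qed

lemma coupled_objective_summand_le:
  fixes a b s t u v :: real
  assumes h: "convex_on I h" and "I \<subseteq> {0<..}" "s \<in> I" "t \<in> I" "u \<ge> 0" "v \<ge> 0" "u + v = 1"
  shows "(u * a + v * b)\<^sup>2 / (u * s + v * t) / 2 + h (u * s + v * t)
       \<le> u * (a\<^sup>2 / s / 2 + h s) + v * (b\<^sup>2 / t / 2 + h t)"
proof -
  have pos: "s > 0" "t > 0" using assms by auto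
  have "u *\<^sub>R s + v *\<^sub>R t \<in> I"
    using assms by (intro convexD[OF convex_on_imp_convex[OF h]]) auto
  then have m: "u * s + v * t > 0" using assms by auto
  have "u * v * (a * t - b * s)\<^sup>2 / (s * t * (u * s + v * t)) \<ge> 0"
    using pos m assms by simp
  then have "(u * a + v * b)\<^sup>2 / (u * s + v * t) \<le> u * (a\<^sup>2 / s) + v * (b\<^sup>2 / t)"
    using square_over_convex_combination[OF pos m assms(7), of a b] by linarith
  then have "(u * a + v * b)\<^sup>2 / (u * s + v * t) / 2 \<le> (u * (a\<^sup>2 / s) + v * (b\<^sup>2 / t)) / 2"
    by (rule divide_right_mono) simp
  moreover have "h (u * s + v * t) \<le> u * h s + v * h t"
    using assms by (auto simp: convex_on_def)
  ultimately have "(u * a + v * b)\<^sup>2 / (u * s + v * t) / 2 + h (u * s + v * t)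
      \<le> (u * (a\<^sup>2 / s) + v * (b\<^sup>2 / t)) / 2 + (u * h s + v * h t)" by (rule add_mono)
  also have "\<dots> = u * (a\<^sup>2 / s / 2 + h s) + v * (b\<^sup>2 / t / 2 + h t)"
    by (simp add: algebra_simps add_divide_distrib)
  finally show ?thesis .
qed

text \<open>The one-variable term makes up for the missing strictness of the perspective along rays:
  it is strict whenever the denominators differ.\<close>

lemma coupled_objective_summand_less:
  fixes a b s t u v :: real
  assumes "s > 0" "t > 0" "u > 0" "v > 0" "u + v = 1"
    and h: "s \<noteq> t \<Longrightarrow> h (u * s + v * t) < u * h s + v * h t"
    and "(a, s) \<noteq> (b, t)"
  shows "(u * a + v * b)\<^sup>2 / (u * s + v * t) / 2 + h (u * s + v * t)
       < u * (a\<^sup>2 / s / 2 + h s) + v * (b\<^sup>2 / t / 2 + h t)"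
proof -
  have m: "u * s + v * t > 0" using assms by (simp add: add_pos_pos)
  note gap = square_over_convex_combination[OF assms(1,2) m assms(5), of a b]
  let ?X = "(u * a + v * b)\<^sup>2 / (u * s + v * t)" and ?Y = "u * (a\<^sup>2 / s) + v * (b\<^sup>2 / t)"
  have "?X / 2 + h (u * s + v * t) < ?Y / 2 + (u * h s + v * h t)"
  proof (cases "s = t")
    case True
    then have "a * t - b * s \<noteq> 0" using assms by auto
    then have "u * v * (a * t - b * s)\<^sup>2 / (s * t * (u * s + v * t)) > 0"
      using m assms by simp
    then have "?X < ?Y" using gap by linarith
    then have "?X / 2 < ?Y / 2" by (rule divide_strict_right_mono) simp
    moreover have "u * s + v * t = s" using True assms by (simp flip: distrib_right)
    moreover have "u * h s + v * h t = h s" using True assms by (simp flip: distrib_right)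
    ultimately show ?thesis by (intro add_less_le_mono) simp_all
  next
    case False
    have "u * v * (a * t - b * s)\<^sup>2 / (s * t * (u * s + v * t)) \<ge> 0"
      using m assms by simp
    then have "?X \<le> ?Y" using gap by linarith
    then have "?X / 2 \<le> ?Y / 2" by (rule divide_right_mono) simp
    with h[OF False] show ?thesis by (intro add_le_less_mono)
  qed
  also have "\<dots> = u * (a\<^sup>2 / s / 2 + h s) + v * (b\<^sup>2 / t / 2 + h t)"
    by (simp add: algebra_simps add_divide_distrib)
  finally show ?thesis .
qed

lemma residual_convex_combination:
  fixes F :: "real^'n^'m"
  assumes "u + v = 1"
  shows "(norm (F *v (u *\<^sub>R x + v *\<^sub>R z) - y))\<^sup>2
       = u * (norm (F *v x - y))\<^sup>2 + v * (norm (F *v z - y))\<^sup>2 - u * v * (norm (F *v x - F *v z))\<^sup>2"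
proof -
  have "F *v (u *\<^sub>R x + v *\<^sub>R z) - (u + v) *\<^sub>R y = u *\<^sub>R (F *v x - y) + v *\<^sub>R (F *v z - y)"
    by (simp add: matrix_vector_right_distrib matrix_vector_mult_scaleR algebra_simps)
  then show ?thesis
    using norm_power2_convex_combination[OF assms, of "F *v x - y" "F *v z - y"] assms by simp
qed

lemma convex_on_coupled_objective:
  fixes F :: "real^'n^'m" and R :: "real^'n^'k"
  assumes "a \<ge> 0" and h: "\<And>i. convex_on (I i) (h i)" and I: "\<And>i. I i \<subseteq> {0<..}"
  shows "convex_on (UNIV \<times> {\<theta>. \<forall>i. \<theta> $ i \<in> I i}) (coupled_objective c a F y R h)"
proof -
  have "convex (UNIV \<times> {\<theta> :: real^'k. \<forall>i. \<theta> $ i \<in> I i})"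
    using convexD[OF convex_on_imp_convex[OF h]]
    by (intro convex_Times) (auto simp: convex_def)
  moreover have "coupled_objective c a F y R h (u *\<^sub>R (x, \<theta>) + v *\<^sub>R (z, \<tau>))
      \<le> u * coupled_objective c a F y R h (x, \<theta>) + v * coupled_objective c a F y R h (z, \<tau>)"
    if \<theta>: "\<forall>i. \<theta> $ i \<in> I i" and \<tau>: "\<forall>i. \<tau> $ i \<in> I i" and uv: "u \<ge> 0" "v \<ge> 0" "u + v = 1"
    for x z \<theta> \<tau> u v
  proof -
    define A where "A w i s = ((R *v w) $ i)\<^sup>2 / s / 2 + h i s" for w i s
  have split: "coupled_objective c a F y R h (w, \<sigma>)
      = c + a * (norm (F *v w - y))\<^sup>2 + (\<Sum>i\<in>UNIV. A w i (\<sigma> $ i))" for w \<sigma>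
    by (simp add: coupled_objective_def A_def)
    have "A (u *\<^sub>R x + v *\<^sub>R z) i (u * \<theta> $ i + v * \<tau> $ i) \<le> u * A x i (\<theta> $ i) + v * A z i (\<tau> $ i)" for i
      using coupled_objective_summand_le[OF h I, of "\<theta> $ i" i "\<tau> $ i" u v] \<theta> \<tau> uv
      by (simp add: A_def matrix_vector_right_distrib matrix_vector_mult_scaleR)
    then have "(\<Sum>i\<in>UNIV. A (u *\<^sub>R x + v *\<^sub>R z) i (u * \<theta> $ i + v * \<tau> $ i))
        \<le> u * (\<Sum>i\<in>UNIV. A x i (\<theta> $ i)) + v * (\<Sum>i\<in>UNIV. A z i (\<tau> $ i))"
      by (simp add: sum_distrib_left sum_mono flip: sum.distrib)
    moreover have "a * (norm (F *v (u *\<^sub>R x + v *\<^sub>R z) - y))\<^sup>2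
        \<le> a * (u * (norm (F *v x - y))\<^sup>2 + v * (norm (F *v z - y))\<^sup>2)"
      using uv \<open>a \<ge> 0\<close>
      by (intro mult_left_mono) (simp_all add: residual_convex_combination[OF uv(3)])
    moreover have "c = u * c + v * c" using uv by (simp flip: distrib_right)
    ultimately show ?thesis
      by (simp add: split) (simp add: algebra_simps)
  qed
  ultimately show ?thesis by (auto simp: convex_on_def)
qed

text \<open>Strict convexity is inherited by the sum because distinct pairs \<open>(x, \<theta>)\<close> are separated
  by \<open>(F x, R x, \<theta>)\<close>, and each of these data enters through a term with a positive gap.\<close>

lemma coupled_objective_strictly_convex:
  fixes F :: "real^'n^'m" and R :: "real^'n^'k" and \<theta> \<tau> :: "real^'k"
  assumes "a > 0" and kernels: "matrix_kernel F \<inter> matrix_kernel R = {0}"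
    and h: "\<And>i s t. \<lbrakk>s > 0; t > 0; s \<noteq> t\<rbrakk> \<Longrightarrow> h i (u * s + v * t) < u * h i s + v * h i t"
    and \<theta>: "\<And>i. \<theta> $ i > 0" and \<tau>: "\<And>i. \<tau> $ i > 0"
    and uv: "u > 0" "v > 0" "u + v = 1" and ne: "(x, \<theta>) \<noteq> (z, \<tau>)"
  shows "coupled_objective c a F y R h (u *\<^sub>R (x, \<theta>) + v *\<^sub>R (z, \<tau>))
       < u * coupled_objective c a F y R h (x, \<theta>) + v * coupled_objective c a F y R h (z, \<tau>)"
proof -
  define A where "A w i s = ((R *v w) $ i)\<^sup>2 / s / 2 + h i s" for w i s
  have split: "coupled_objective c a F y R h (w, \<sigma>)
      = c + a * (norm (F *v w - y))\<^sup>2 + (\<Sum>i\<in>UNIV. A w i (\<sigma> $ i))" for w \<sigma>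
    by (simp add: coupled_objective_def A_def)
  let ?L = "\<lambda>i. A (u *\<^sub>R x + v *\<^sub>R z) i (u * \<theta> $ i + v * \<tau> $ i)"
  let ?R = "\<lambda>i. u * A x i (\<theta> $ i) + v * A z i (\<tau> $ i)"
  have less: "?L i < ?R i" if "((R *v x) $ i, \<theta> $ i) \<noteq> ((R *v z) $ i, \<tau> $ i)" for i
    using coupled_objective_summand_less[where h = "h i", OF \<theta> \<tau> uv h[OF \<theta> \<tau>] that]
    by (simp add: A_def matrix_vector_right_distrib matrix_vector_mult_scaleR)
  have le: "?L i \<le> ?R i" for i
  proof (cases "((R *v x) $ i, \<theta> $ i) = ((R *v z) $ i, \<tau> $ i)")
    case True
    then show ?thesis using uv
      by (simp add: A_def matrix_vector_right_distrib matrix_vector_mult_scaleR flip: distrib_right)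
  qed (use less in \<open>auto intro: less_imp_le\<close>)
  have sum: "(\<Sum>i\<in>UNIV. ?R i) = u * (\<Sum>i\<in>UNIV. A x i (\<theta> $ i)) + v * (\<Sum>i\<in>UNIV. A z i (\<tau> $ i))"
    by (simp add: sum.distrib sum_distrib_left)
  let ?N = "\<lambda>w. a * (norm (F *v w - y))\<^sup>2"
  have gap: "?N (u *\<^sub>R x + v *\<^sub>R z) = u * ?N x + v * ?N z - a * (u * v * (norm (F *v x - F *v z))\<^sup>2)"
    unfolding residual_convex_combination[OF uv(3)] by (simp add: algebra_simps)
  have "?N (u *\<^sub>R x + v *\<^sub>R z) + (\<Sum>i\<in>UNIV. ?L i) < u * ?N x + v * ?N z + (\<Sum>i\<in>UNIV. ?R i)"
  proof (cases "F *v x = F *v z")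
    case False
    then have "a * (u * v * (norm (F *v x - F *v z))\<^sup>2) > 0" using \<open>a > 0\<close> uv by simp
    then have "?N (u *\<^sub>R x + v *\<^sub>R z) < u * ?N x + v * ?N z" using gap by linarith
    then show ?thesis by (intro add_less_le_mono sum_mono le)
  next
    case True
    \<comment> \<open>Here \<open>x - z\<close> lies in the kernel of \<open>F\<close>, so it can lie in that of \<open>R\<close> only if it is 0.\<close>
    have "R *v x \<noteq> R *v z" if "x \<noteq> z"
    proof
      assume "R *v x = R *v z"
      then have "x - z \<in> matrix_kernel F \<inter> matrix_kernel R"
        using True by (simp add: matrix_kernel_def matrix_vector_mult_diff_distrib)
      then show False using kernels that by simp
    qed
    then obtain i where "((R *v x) $ i, \<theta> $ i) \<noteq> ((R *v z) $ i, \<tau> $ i)"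
      using ne by (auto simp: vec_eq_iff)
    then have "(\<Sum>i\<in>UNIV. ?L i) < (\<Sum>i\<in>UNIV. ?R i)"
      using less le by (intro sum_strict_mono_ex1) auto
    then show ?thesis using True gap by simp
  qed
  moreover have "c = u * c + v * c" using uv by (simp flip: distrib_right)
  ultimately show ?thesis unfolding sum
    by (simp add: split) (simp add: algebra_simps)
qed

section \<open>Strict and local convexity of the objective\<close>

theorem corollary3p3:
  fixes F :: "real^'n^'m" and y :: "real^'m" and R :: "real^'n^'k"
    and r \<beta> \<eta> :: real and \<theta>0 :: "real^'k"
    and r' \<beta>' \<eta>' \<theta>0' \<nu> :: real
  assumes kernels: "matrix_kernel F \<inter> matrix_kernel R = {0}"
    and "r \<noteq> 0" and "\<beta> > 0" and "\<And>i. \<theta>0 $ i > 0"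
    and "\<eta> = r * \<beta> - 3 / 2"
    and "r' \<noteq> 0" and "\<beta>' > 0" and "\<theta>0' > 0"
    and "\<eta>' = r' * \<beta>' - (real CARD('m) + 2) / 2"
    and "\<nu> > 0"
  shows "(r \<ge> 1 \<and> \<eta> > 0 \<longrightarrow>
            globally_strictly_convex (objective F y R r \<eta> \<theta>0 r' \<eta>' \<theta>0' \<nu>))
       \<and> ((0 < r \<and> r < 1 \<and> \<eta> > 0) \<or> r < 0 \<longrightarrow>
            (\<forall>x \<theta>. (\<forall>i. \<theta> $ i > 0) \<and>
                   (\<forall>i. \<theta> $ i < \<theta>0 $ i * (\<eta> / (r * \<bar>r - 1\<bar>)) powr (1 / r)) \<longrightarrow>
              locally_convex_at (objective F y R r \<eta> \<theta>0 r' \<eta>' \<theta>0' \<nu>) (x, \<theta>)))"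
proof -
  let ?G = "objective F y R r \<eta> \<theta>0 r' \<eta>' \<theta>0' \<nu>"
  define h where "h i t = (t / \<theta>0 $ i) powr r - \<eta> * ln t" for i t
  define g where "g = coupled_objective ((\<nu> / \<theta>0') powr r' - \<eta>' * ln \<nu>) (1 / (2 * \<nu>)) F y R h"
  have G: "?G (x, \<theta>) = ereal (g (x, \<theta>))" if "\<And>i. \<theta> $ i > 0" for x \<theta>
    using objective_eq_coupled_objective[OF that] by (simp add: g_def h_def[abs_def])
  show ?thesis
  proof (intro conjI impI allI)
    assume r: "r \<ge> 1 \<and> \<eta> > 0"
    have conv: "convex (UNIV \<times> {\<theta> :: real^'k. \<forall>i. \<theta> $ i > 0} :: ((real^'n) \<times> (real^'k)) set)"
      using convexD[OF convex_real_interval(3)[of 0]]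
      by (intro convex_Times) (auto simp: convex_def)
    have "?G (u *\<^sub>R (x, \<theta>) + v *\<^sub>R (z, \<tau>)) < ereal u * ?G (x, \<theta>) + ereal v * ?G (z, \<tau>)"
      if \<theta>: "\<forall>i. \<theta> $ i > 0" and \<tau>: "\<forall>i. \<tau> $ i > 0" and uv: "u > 0" "v > 0" "u + v = 1"
        and ne: "(x, \<theta>) \<noteq> (z, \<tau>)" for x z \<theta> \<tau> u v
    proof -
      have "g (u *\<^sub>R (x, \<theta>) + v *\<^sub>R (z, \<tau>)) < u * g (x, \<theta>) + v * g (z, \<tau>)"
        unfolding g_def
      proof (rule coupled_objective_strictly_convex[OF _ kernels])
        show "h i (u * s + v * t) < u * h i s + v * h i t" if "s > 0" "t > 0" "s \<noteq> t" for i s t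
          unfolding h_def using assms r uv that by (intro powr_minus_ln_strictly_convex) auto
      qed (use \<theta> \<tau> uv ne \<open>\<nu> > 0\<close> in auto)
      moreover have "?G (u *\<^sub>R (x, \<theta>) + v *\<^sub>R (z, \<tau>)) = ereal (g (u *\<^sub>R (x, \<theta>) + v *\<^sub>R (z, \<tau>)))"
        using \<theta> \<tau> uv by (simp add: G add_pos_pos)
      ultimately show ?thesis using \<theta> \<tau> by (simp add: G)
    qed
    with conv show "globally_strictly_convex ?G"
      unfolding globally_strictly_convex_def effective_domain_objective ereal_strictly_convex_on_def
      by fastforce
  next
    fix x :: "real^'n" and \<theta> :: "real^'k"
    assume r: "(0 < r \<and> r < 1 \<and> \<eta> > 0) \<or> r < 0"
      and \<theta>: "(\<forall>i. \<theta> $ i > 0) \<and> (\<forall>i. \<theta> $ i < \<theta>0 $ i * (\<eta> / (r * \<bar>r - 1\<bar>)) powr (1 / r))"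
    \<comment> \<open>For negative \<open>r\<close> the sign of \<open>\<eta>\<close> is forced by \<open>\<eta> = r \<beta> - 3/2\<close> with \<open>\<beta> > 0\<close>.\<close>
    have "\<eta> < 0" if "r < 0" using mult_neg_pos[OF that \<open>\<beta> > 0\<close>] assms(5) by linarith
    with r have cases: "0 < r \<and> r < 1 \<and> \<eta> > 0 \<or> r < 0 \<and> \<eta> < 0" by auto
    define I where "I i = {0<..<\<theta>0 $ i * (\<eta> / (r * \<bar>r - 1\<bar>)) powr (1 / r)}" for i
    define U where "U = (UNIV :: (real^'n) set) \<times> {\<tau> :: real^'k. \<forall>i. \<tau> $ i \<in> I i}"
    have "convex_on (I i) (h i)" for i
      unfolding h_def
      using assms curvature_nonneg_below_threshold[OF _ _ cases]
      by (intro convex_on_powr_minus_ln) (auto simp: I_def)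
    then have "convex_on U g" unfolding U_def g_def
      using \<open>\<nu> > 0\<close> by (intro convex_on_coupled_objective) (auto simp: I_def)
    moreover have "?G p = ereal (g p)" if "p \<in> U" for p
      using that by (cases p) (auto simp: U_def I_def G)
    ultimately have "ereal_convex_on U ?G" using ereal_convex_on_iff_convex_on by blast
    moreover have "open {\<tau> :: real^'k. \<forall>i. \<tau> $ i \<in> I i}"
    proof -
      have "{\<tau> :: real^'k. \<forall>i. \<tau> $ i \<in> I i} = (\<Inter>i. (\<lambda>\<tau>. \<tau> $ i) -` I i)" by auto
      then show ?thesis
        by (auto simp: I_def intro!: open_INT open_vimage continuous_intros)
    qed
    then have "open U" unfolding U_def by (intro open_Times) auto
    moreover have "(x, \<theta>) \<in> U" using \<theta> by (auto simp: U_def I_def)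
    ultimately show "locally_convex_at ?G (x, \<theta>)" unfolding locally_convex_at_def by blast
  qed
qed

end
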